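(* Let $m$ be a positive integer and let $a$ be a real number with $a\notin\mathbb{Z}$. Then \begin{align*} \sum_{n=1}^\infty \frac{\zeta_n(2m)}{n(n^2-a^2)} &=\frac12\sum_{n=1}^\infty \frac{1}{n^{2m+1}(n^2-a^2)}-\frac{\pi\cot(\pi a)}{4a^2}\sum_{n=1}^\infty\left\{\frac{1}{(n-a)^{2m}}-\frac{1}{(n+a)^{2m}}\right\}\\ &\quad+\frac{1}{2a^2}\sum_{k=1}^m\zeta(2k)\sum_{n=1}^\infty\left\{\frac{1}{(n+a)^{2m-2k+1}}+\frac{1}{(n-a)^{2m-2k+1}}-\frac{2}{n^{2m-2k+1}}\right\}\\ &\quad+\frac{m}{a^2}\zeta(2m+1)-\frac{1}{4a^2}\sum_{n=1}^\infty\left\{\frac{1}{(n+a)^{2m+1}}+\frac{1}{(n-a)^{2m+1}}-\frac{2}{n^{2m+1}}\right\}. \end{align*}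
   Context: $\zeta_n(k)=\sum_{j=1}^n j^{-k}$ is the generalized harmonic number and $\zeta(s)=\sum_{n\ge1}n^{-s}$ is the Riemann zeta function. *)

theory Defs
  imports Complex_Main
begin

(* zeta_n(k) in the paper's notation is gharm n k. *)
definition gharm :: "nat \<Rightarrow> nat \<Rightarrow> real" where
  "gharm n k = (\<Sum>j=1..n. 1 / real j ^ k)"

(* The Riemann zeta function on its half-line of convergence s > 1; the value is
   meaningless for other s. *)
definition zeta :: "real \<Rightarrow> real" where
  "zeta s = (\<Sum>n. 1 / real (Suc n) powr s)"

end

(*
  Write h(t) = 1/(t-a) + 1/(t+a) - 2/t, an odd function with h(n) = 2a^2/(n(n^2-a^2)), and
  h(0) = 0. The absolutely convergent double sum over i, n >= 1 of (h(n-i) + h(n+i)) / i^(2m) is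
  evaluated in both orders. For fixed i the sum over n telescopes to twice the tail of h from i on,
  minus h(i); summing these tails by parts produces the harmonic numbers. For fixed n the sum over i
  consists of the partial fraction series of pi cot(pi y) at y = n+a and y = n-a (and its
  regularised version at y = n) with weights i^(-2m); the identity
  i^(-2) / (y^2-i^2) = y^(-2) (1 / (y^2-i^2) + i^(-2)) removes the weights two powers at a time and
  leaves the values zeta(2k).
*)
theory Submission
  imports Defs "HOL-Analysis.Gamma_Function" "HOL-Real_Asymp.Real_Asymp"
begin

section \<open>Interchange of summation for series\<close>

text \<open>Fubini for series: a summable bound on the absolute row sums gives absolute summability
  over all pairs. The interchange is then made for unordered sums, and \<open>infsum_suminf\<close>
  carries it back to series.\<close>

lemma sums_swap:
  fixes F :: "nat \<Rightarrow> nat \<Rightarrow> real"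
  assumes abs: "\<And>i. summable (\<lambda>n. \<bar>F i n\<bar>)"
    and bound: "\<And>i. (\<Sum>n. \<bar>F i n\<bar>) \<le> c i" and c: "summable c"
  shows "(\<lambda>n. \<Sum>i. F i n) sums (\<Sum>i. \<Sum>n. F i n)"
    and "summable (\<lambda>i. \<Sum>n. F i n)"
proof -
  have infsum_suminf: "infsum f UNIV = suminf f" if "f summable_on UNIV" for f :: "nat \<Rightarrow> real"
    using has_sum_imp_sums[OF has_sum_infsum[OF that]] by (simp add: sums_iff)
  have row: "F i abs_summable_on UNIV" for i
    using abs[of i] by (intro norm_summable_imp_summable_on) simp
  have row_abs: "(\<Sum>\<^sub>\<infinity>n. norm (F i n)) = (\<Sum>n. \<bar>F i n\<bar>)" for i
    using infsum_suminf[OF row[of i]] by simp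
  have nonneg: "0 \<le> (\<Sum>n. \<bar>F i n\<bar>)" for i
    by (intro suminf_nonneg abs) simp
  have "summable (\<lambda>i. \<Sum>n. \<bar>F i n\<bar>)"
    by (rule summable_comparison_test'[OF c, of 0]) (use nonneg bound in simp)
  hence "(\<lambda>i. \<Sum>\<^sub>\<infinity>n. norm (F i n)) abs_summable_on UNIV"
    unfolding row_abs using nonneg by (intro norm_summable_imp_summable_on) simp
  with row have "(\<lambda>(i, n). F i n) abs_summable_on UNIV \<times> UNIV"
    by (subst abs_summable_on_Sigma_iff) auto
  hence S: "(\<lambda>(i, n). F i n) summable_on UNIV \<times> UNIV"
    using abs_summable_summable by blast
  hence S': "(\<lambda>(n, i). F i n) summable_on UNIV \<times> UNIV"
    by (subst (asm) summable_on_swap) (simp add: case_prod_unfold)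
  have rows: "F i summable_on UNIV" for i
    using summable_on_SigmaD1[OF S, of i] by simp
  have cols: "(\<lambda>i. F i n) summable_on UNIV" for n
    using summable_on_SigmaD1[OF S', of n] by simp
  have 1: "(\<lambda>i. \<Sum>n. F i n) summable_on UNIV"
    using summable_on_Sigma_banach[OF S] by (simp add: infsum_suminf rows)
  have 2: "(\<lambda>n. \<Sum>i. F i n) summable_on UNIV"
    using summable_on_Sigma_banach[OF S'] by (simp add: infsum_suminf cols)
  show "summable (\<lambda>i. \<Sum>n. F i n)"
    using 1 by (rule summable_on_imp_summable)
  have "(\<Sum>i. \<Sum>n. F i n) = (\<Sum>n. \<Sum>i. F i n)"
    using infsum_swap_banach[OF S] by (simp add: infsum_suminf rows cols 1 2)
  thus "(\<lambda>n. \<Sum>i. F i n) sums (\<Sum>i. \<Sum>n. F i n)"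
    using summable_on_imp_summable[OF 2] by (simp add: sums_iff)
qed

section \<open>Partial fraction series, plain and weighted by even powers\<close>

text \<open>Differentiating the reflection formula at y gives Digamma(1 - y) - Digamma(y) = pi
  cot(pi y). The defining series of the two Digamma values then yields the partial
  fractions.\<close>

lemma cot_partial_fractions:
  fixes y :: real
  assumes y: "y \<notin> \<int>"
  shows "(\<lambda>i. 1 / (y - real (Suc i)) + 1 / (y + real (Suc i))) sums (pi * cot (pi * y) - 1 / y)"
proof -
  have y0: "y \<noteq> 0" using y by auto
  have "1 - y \<notin> \<int>"
    using y by (metis Ints_1 Ints_diff diff_diff_eq2 add_diff_cancel_left')
  hence nonpos: "y \<notin> \<int>\<^sub>\<le>\<^sub>0" "1 - y \<notin> \<int>\<^sub>\<le>\<^sub>0" "1 - y \<noteq> 0"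
    using y nonpos_Ints_subset_Ints by (auto dest: nonpos_Ints_Int)
  have sin: "sin (pi * y) \<noteq> 0"
    using y sin_zero_iff_int2[of "pi * y"] by (auto simp: mult.commute)
  \<comment> \<open>The complex reflection formula, restricted to real arguments. The reciprocal
    \<open>rGamma\<close> has no poles, so the identity holds for every x and both sides can be
    differentiated as functions.\<close>
  have refl: "rGamma x * rGamma (1 - x) = sin (pi * x) / pi" for x :: real
  proof -
    have "complex_of_real (rGamma x * rGamma (1 - x)) = of_real (sin (pi * x) / pi)"
      using rGamma_reflection_complex[of "of_real x"]
        rGamma_complex_of_real[of x] rGamma_complex_of_real[of "1 - x"]
        sin_of_real[of "pi * x", where 'a = complex]
      by simp
    thus ?thesis by (simp only: of_real_eq_iff)
  qed
  have "((\<lambda>x. rGamma x * rGamma (1 - x)) has_real_derivative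
      rGamma y * rGamma (1 - y) * (Digamma (1 - y) - Digamma y)) (at y)"
    using nonpos by (auto intro!: derivative_eq_intros simp: algebra_simps)
  moreover have "((\<lambda>x. sin (pi * x) / pi) has_real_derivative cos (pi * y)) (at y)"
    by (auto intro!: derivative_eq_intros)
  ultimately have "sin (pi * y) / pi * (Digamma (1 - y) - Digamma y) = cos (pi * y)"
    unfolding refl by (rule DERIV_unique)
  hence "Digamma (1 - y) - Digamma y = pi * cot (pi * y)"
    using sin by (simp add: cot_def field_simps)
  \<comment> \<open>Moving y to 1 + y splits off the term 1/y, so that both series start at the
    poles nearest to 0, namely 1 and -1.\<close>
  hence dig: "Digamma (1 - y) - Digamma (1 + y) = pi * cot (pi * y) - 1 / y"
    using Digamma_plus1[OF y0] by (simp add: add_ac)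
  have "(\<lambda>i. inverse (real (Suc i)) - inverse (z + real i)) sums (Digamma z + euler_mascheroni)"
    if "z \<noteq> 0" for z :: real
    using summable_Digamma[OF that] by (simp add: Digamma_def sums_iff)
  note ds = this
  have "1 + y \<noteq> 0" using y by (metis Ints_1 Ints_minus add_eq_0_iff minus_minus)
  from sums_diff[OF ds[OF nonpos(3)] ds[OF this]]
  have *: "(\<lambda>i. inverse (1 + y + real i) - inverse (1 - y + real i)) sums (pi * cot (pi * y) - 1 / y)"
    by (simp add: dig)
  have "inverse (1 + y + real i) - inverse (1 - y + real i) =
      1 / (y - real (Suc i)) + 1 / (y + real (Suc i))" for i
  proof -
    have "inverse (1 - y + real i) = - (1 / (y - real (Suc i)))"
      by (subst minus_divide_right) (simp add: inverse_eq_divide algebra_simps)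
    thus ?thesis by (simp add: inverse_eq_divide algebra_simps)
  qed
  with * show ?thesis by simp
qed

text \<open>With the singular index removed, the partial sums are differences of harmonic numbers.
  Beyond index n they equal H(2n+N) - H(N) - 3/(2n), and the difference H(2n+N) - H(N) tends to
  0.\<close>

lemma integer_partial_fractions:
  assumes "n > 0"
  shows "(\<lambda>i. if Suc i = n then 0
           else 1 / (real n - real (Suc i)) + 1 / (real n + real (Suc i))) sums (- 3 / (2 * real n))"
    (is "?c sums _")
proof -
  have low: "(\<Sum>i<k. ?c i) = harm (n - 1) - harm (n - 1 - k) + harm (n + k) - harm n"
    if "k \<le> n - 1" for k
    using that
  proof (induction k)
    case (Suc k)
    have "n - 1 - k = Suc (n - 1 - Suc k)" using Suc.prems by simp
    hence "harm (n - 1 - k) = harm (n - 1 - Suc k) + 1 / real (n - 1 - k)"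
      by (simp add: harm_Suc inverse_eq_divide)
    moreover have "harm (n + Suc k) = harm (n + k) + 1 / (real n + real (Suc k))"
      by (simp add: harm_Suc inverse_eq_divide)
    moreover have "real (n - 1 - k) = real n - real (Suc k)"
      using Suc.prems by (simp add: of_nat_diff)
    moreover have "Suc k \<noteq> n" using Suc.prems assms by simp
    ultimately show ?case using Suc by simp
  qed simp
  have high: "(\<Sum>i<n + N. ?c i) = harm (2 * n + N) - harm N - 3 / (2 * real n)" for N
  proof (induction N)
    case 0
    \<comment> \<open>The index i = n - 1 is the removed one. The constant 3/(2n) arises here: 1/n
      from H(n-1) = H(n) - 1/n, and 1/(2n) from the removed term of H(2n).\<close>
    have "(\<Sum>i<n. ?c i) = (\<Sum>i<n - 1. ?c i)"
      using assms by (cases n) auto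
    also have "\<dots> = harm (n - 1) - harm n + harm (n + (n - 1)) - harm 0"
      using low[of "n - 1"] by simp
    also have "harm (n - 1) = harm n - 1 / real n"
      using assms by (cases n) (simp_all add: harm_Suc inverse_eq_divide)
    also have "harm (n + (n - 1)) = harm (2 * n) - 1 / (2 * real n)"
    proof -
      have "2 * n = Suc (n + (n - 1))" using assms by simp
      moreover have "real (2 * n) = 2 * real n" by simp
      ultimately show ?thesis by (metis add_diff_cancel_right' harm_Suc inverse_eq_divide)
    qed
    finally show ?case by (simp add: harm_expand)
  next
    case (Suc N)
    have "?c (n + N) = 1 / (2 * real n + real N + 1) - 1 / real (Suc N)"
    proof -
      have "real n - real (Suc (n + N)) = - real (Suc N)" by simp
      moreover have "real n + real (Suc (n + N)) = 2 * real n + real N + 1" by simp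
      ultimately show ?thesis by (simp only: minus_divide_right[symmetric]) simp
    qed
    with Suc show ?case by (simp add: harm_Suc inverse_eq_divide algebra_simps)
  qed
  have "(\<lambda>N. harm (N + k) - harm N :: real) \<longlonglongrightarrow> 0" for k
  proof (induction k)
    case (Suc k)
    have "(\<lambda>N. 1 / real (Suc (N + k))) \<longlonglongrightarrow> 0" by real_asymp
    from tendsto_add[OF Suc this] show ?case
      by (simp add: harm_Suc inverse_eq_divide algebra_simps)
  qed simp
  from tendsto_diff[OF this[of "2 * n"] tendsto_const[of "3 / (2 * real n)"]]
  have "(\<lambda>N. \<Sum>i<N + n. ?c i) \<longlonglongrightarrow> - 3 / (2 * real n)"
    using high by (simp add: add.commute)
  thus ?thesis
    unfolding sums_def by (rule LIMSEQ_offset)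
qed

text \<open>With x = i + 1, the relation \<open>cd\<close> gives c/x^2 = c/y^2 + (2/y) d/x^2, so
  each induction step trades two powers of x for two powers of y and one new value Z. The sequence d
  is constantly 1 for non-integer y, and omits the singular index when y is an integer.\<close>

lemma weighted_partial_fractions:
  fixes c d :: "nat \<Rightarrow> real"
  assumes y: "y \<noteq> 0" and c: "c sums C"
    and d: "\<And>k. k > 0 \<Longrightarrow> (\<lambda>i. d i / real (Suc i) ^ (2 * k)) sums Z k"
    and cd: "\<And>i. c i * (y ^ 2 - real (Suc i) ^ 2) = 2 * y * d i"
  shows "(\<lambda>i. c i / real (Suc i) ^ (2 * m)) sums
           (C / y ^ (2 * m) + 2 * (\<Sum>k = 1..m. Z k / y ^ (2 * m - 2 * k + 1)))"
proof (induction m)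
  case 0
  with c show ?case by simp
next
  case (Suc m)
  have split: "c i / real (Suc i) ^ (2 * Suc m) =
      c i / real (Suc i) ^ (2 * m) / y ^ 2 + 2 / y * (d i / real (Suc i) ^ (2 * Suc m))" for i
  proof -
    define x where "x = real (Suc i)"
    define P where "P = x ^ (2 * m)"
    have x: "x \<noteq> 0" "P \<noteq> 0" by (simp_all add: x_def P_def)
    have "c i * y ^ 2 = c i * x ^ 2 + 2 * y * d i"
      using cd[of i] by (simp add: x_def algebra_simps)
    hence "c i / (P * x ^ 2) = c i / P / y ^ 2 + 2 / y * (d i / (P * x ^ 2))"
      using x y by (simp add: field_simps power2_eq_square)
    moreover have "x ^ (2 * Suc m) = P * x ^ 2"
      by (simp add: P_def power_add power2_eq_square)
    ultimately show ?thesis by (simp only: x_def P_def)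
  qed
  \<comment> \<open>Dividing by y^2 raises every old exponent by 2. The new term k = m + 1 has
    exponent 1 and is supplied by the summand with d.\<close>
  have shift: "(\<Sum>k = 1..m. Z k / y ^ (2 * m - 2 * k + 1)) / y ^ 2 =
      (\<Sum>k = 1..m. Z k / y ^ (2 * Suc m - 2 * k + 1))"
    unfolding sum_divide_distrib
  proof (intro sum.cong refl)
    fix k assume "k \<in> {1..m}"
    hence "2 * Suc m - 2 * k + 1 = (2 * m - 2 * k + 1) + 2" by auto
    thus "Z k / y ^ (2 * m - 2 * k + 1) / y ^ 2 = Z k / y ^ (2 * Suc m - 2 * k + 1)"
      by (simp add: power_add power2_eq_square)
  qed
  have "C / y ^ (2 * m) / y ^ 2 = C / y ^ (2 * Suc m)"
    by (simp add: power2_eq_square mult_ac)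
  hence val: "(C / y ^ (2 * m) + 2 * (\<Sum>k = 1..m. Z k / y ^ (2 * m - 2 * k + 1))) / y ^ 2
        + 2 / y * Z (Suc m)
      = C / y ^ (2 * Suc m) + 2 * (\<Sum>k = 1..Suc m. Z k / y ^ (2 * Suc m - 2 * k + 1))"
    unfolding sum.cl_ivl_Suc shift[symmetric] by (simp add: add_divide_distrib)
  show ?case
    unfolding split val[symmetric]
    by (intro sums_add sums_divide sums_mult Suc d) simp
qed


section \<open>Zeta series and inverse powers of shifted integers\<close>

lemma zeta_nat_sums:
  assumes "k > 1"
  shows "(\<lambda>i. 1 / real (Suc i) ^ k) sums zeta (real k)"
proof -
  have "summable (\<lambda>i. 1 / real (Suc i) ^ k)"
    using assms inverse_power_summable[of k, where 'a = real] summable_Suc_iff[of "\<lambda>i. inverse (real i ^ k)"]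
    by (simp add: inverse_eq_divide)
  thus ?thesis
    unfolding zeta_def by (simp add: powr_realpow sums_iff del: of_nat_Suc)
qed

lemma summable_shifted_power:
  fixes b :: real
  assumes "q \<ge> 2"
  shows "summable (\<lambda>n. 1 / (real (Suc n) + b) ^ q)"
proof (rule summable_comparison_test_ev)
  \<comment> \<open>Since b may be negative, the powers are comparable only once the base is at
    least 1.\<close>
  show "\<forall>\<^sub>F n in sequentially. norm (1 / (real (Suc n) + b) ^ q) \<le> 1 / (real (Suc n) + b) ^ 2"
  proof (rule eventually_mono)
    show "\<forall>\<^sub>F n in sequentially. real (Suc n) + b \<ge> 1" by real_asymp
    show "norm (1 / (x + b) ^ q) \<le> 1 / (x + b) ^ 2" if "x + b \<ge> 1" for x
      using that assms by (auto intro!: divide_left_mono power_increasing)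
  qed
  show "summable (\<lambda>n. 1 / (real (Suc n) + b) ^ 2)"
  proof (rule summable_comparison_test_bigo)
    show "summable (\<lambda>n. norm (1 / real (Suc n) ^ 2))"
      using zeta_nat_sums[of 2] by (simp add: sums_iff)
    show "(\<lambda>n. 1 / (real (Suc n) + b) ^ 2) \<in> O(\<lambda>n. 1 / real (Suc n) ^ 2)" by real_asymp
  qed
qed

section \<open>The odd kernel and sums over its shifts\<close>

text \<open>This is the function h of the overview. Its value 0 at t = 0 fits its oddness, and is
  what the diagonal i = n contributes through n - i.\<close>

definition kern :: "real \<Rightarrow> real \<Rightarrow> real" where
  "kern a t = (if t = 0 then 0 else 1 / (t + a) + 1 / (t - a) - 2 / t)"

lemma kern_minus: "kern a (- t) = - kern a t"
proof -
  have "1 / (- t + a) = - (1 / (t - a))" "1 / (- t - a) = - (1 / (t + a))"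
    using divide_minus_right[of 1 "t - a"] divide_minus_right[of 1 "t + a"] by simp_all
  thus ?thesis by (simp add: kern_def)
qed

lemma kern_eq:
  assumes "t \<noteq> a" "t \<noteq> - a"
  shows "kern a t = 2 * a ^ 2 / (t * (t ^ 2 - a ^ 2))"
\<comment> \<open>At t = 0 both sides are 0, the right-hand one by the convention for division by
  zero.\<close>
proof (cases "t = 0")
  case False
  have "t + a \<noteq> 0" "t - a \<noteq> 0" using assms by auto
  moreover have "t ^ 2 - a ^ 2 = (t + a) * (t - a)" by (simp add: power2_eq_square algebra_simps)
  ultimately show ?thesis using False
    by (simp add: kern_def divide_simps) (simp add: power2_eq_square algebra_simps)
qed (simp add: kern_def)

text \<open>The leading terms 1/t cancel, so the summands are of order at most 1/n^2.\<close>

lemma summable_kern: "summable (\<lambda>n. \<bar>kern a (real n)\<bar>)"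
proof -
  have "summable (\<lambda>n. \<bar>1 / (real (Suc n) + a) + 1 / (real (Suc n) - a) - 2 / real (Suc n)\<bar>)"
  proof (rule summable_comparison_test_bigo)
    show "summable (\<lambda>n. norm (1 / real (Suc n) ^ 2))"
      using zeta_nat_sums[of 2] by (simp add: sums_iff)
    have "(\<lambda>n. 1 / (real (Suc n) + a) + 1 / (real (Suc n) - a) - 2 / real (Suc n))
        \<in> O(\<lambda>n. 1 / real (Suc n) ^ 2)" by real_asymp
    thus "(\<lambda>n. \<bar>1 / (real (Suc n) + a) + 1 / (real (Suc n) - a) - 2 / real (Suc n)\<bar>)
        \<in> O(\<lambda>n. 1 / real (Suc n) ^ 2)" by simp
  qed
  thus ?thesis
    by (subst summable_Suc_iff[symmetric]) (simp add: kern_def)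
qed

text \<open>In the series shifted by -i, the first i arguments are -(i-1), ..., 0; parity folds them
  onto 0, ..., i-1, and the rest is the full sum because f(0) = 0. It is applied with s = -1 to the
  kernel and with s = 1 to its absolute value.\<close>

lemma sums_shift_parity:
  fixes f :: "real \<Rightarrow> real"
  assumes f: "(\<lambda>n. f (real n)) sums S" and f0: "f 0 = 0" and sym: "\<And>t. f (- t) = s * f t"
  shows "(\<lambda>n. f (real (Suc n) - real i)) sums (S + s * (\<Sum>t<i. f (real t)))"
    and "(\<lambda>n. f (real (Suc n) + real i)) sums (S - (\<Sum>t<Suc i. f (real t)))"
proof -
  have "(\<lambda>n. f (real (Suc n))) sums S"
    using f f0 sums_Suc_iff[of "\<lambda>n. f (real n)" S] by simp
  hence tail: "(\<lambda>n. f (real (Suc (n + i)) - real i)) sums S" by (simp add: add_ac)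
  have "(\<Sum>n<i. f (real (Suc n) - real i)) = (\<Sum>n<i. s * f (real (i - Suc n)))"
  proof (intro sum.cong refl)
    fix n assume "n \<in> {..<i}"
    hence "real (Suc n) - real i = - real (i - Suc n)" by (auto simp: of_nat_diff)
    thus "f (real (Suc n) - real i) = s * f (real (i - Suc n))" by (simp only: sym)
  qed
  also have "\<dots> = s * (\<Sum>t<i. f (real t))"
    by (simp only: sum_distrib_left[symmetric] sum.nat_diff_reindex[of "\<lambda>t. f (real t)"])
  finally show "(\<lambda>n. f (real (Suc n) - real i)) sums (S + s * (\<Sum>t<i. f (real t)))"
    using tail sums_iff_shift[of "\<lambda>n. f (real (Suc n) - real i)" i S] by simp
  from sums_split_initial_segment[OF f, of "Suc i"]
  show "(\<lambda>n. f (real (Suc n) + real i)) sums (S - (\<Sum>t<Suc i. f (real t)))"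
    by (simp add: add_ac)
qed

section \<open>Tails of the kernel, uniform bounds and the double sum\<close>

context
  fixes a :: real and m :: nat
begin

definition ktotal where "ktotal = (\<Sum>n. kern a (real n))"

definition kabs where "kabs = (\<Sum>n. \<bar>kern a (real n)\<bar>)"

lemma kern_sums: "(\<lambda>n. kern a (real n)) sums ktotal" "(\<lambda>n. \<bar>kern a (real n)\<bar>) sums kabs"
  using summable_kern[of a] summable_rabs_cancel[OF summable_kern[of a]]
  by (simp_all add: ktotal_def kabs_def summable_sums)

lemma kern_partial_abs: "(\<Sum>t<i. \<bar>kern a (real t)\<bar>) \<le> kabs"
  unfolding kabs_def by (intro sum_le_suminf summable_kern) auto

text \<open>By oddness the shift by -i leaves the tail of the kernel from i on, and the shift by +i
  leaves the tail from i + 1 on. Writing the second as the first minus h(i) gives the stated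
  form.\<close>

lemma shifted_kern_sums:
  "(\<lambda>n. kern a (real (Suc n) - real i) + kern a (real (Suc n) + real i)) sums
     (2 * (ktotal - (\<Sum>t<i. kern a (real t))) - kern a (real i))"
proof -
  have sym: "kern a (- t) = - 1 * kern a t" for t by (simp add: kern_minus)
  have "kern a 0 = 0" by (simp add: kern_def)
  from sums_add[OF sums_shift_parity[OF kern_sums(1) this sym, of i]]
  show ?thesis by (simp add: algebra_simps)
qed

text \<open>The bound is uniform in i, so the weights i^(-2m) alone control absolute convergence of
  the double sum.\<close>

lemma shifted_kern_abs:
  "summable (\<lambda>n. \<bar>kern a (real (Suc n) - real i) + kern a (real (Suc n) + real i)\<bar>)"
  "(\<Sum>n. \<bar>kern a (real (Suc n) - real i) + kern a (real (Suc n) + real i)\<bar>) \<le> 3 * kabs"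
proof -
  have "\<bar>kern a 0\<bar> = 0" "\<And>t. \<bar>kern a (- t)\<bar> = 1 * \<bar>kern a t\<bar>"
    by (simp add: kern_def, simp add: kern_minus)
  note S = sums_add[OF sums_shift_parity[OF kern_sums(2) this, of i]]
  show 1: "summable (\<lambda>n. \<bar>kern a (real (Suc n) - real i) + kern a (real (Suc n) + real i)\<bar>)"
    by (rule summable_comparison_test'[OF sums_summable[OF S], of 0]) simp
  have "(\<Sum>n. \<bar>kern a (real (Suc n) - real i) + kern a (real (Suc n) + real i)\<bar>) \<le>
      kabs + 1 * (\<Sum>t<i. \<bar>kern a (real t)\<bar>) + (kabs - (\<Sum>t<Suc i. \<bar>kern a (real t)\<bar>))"
    by (rule sums_le[OF _ summable_sums[OF 1] S]) simp
  also have "\<dots> \<le> 3 * kabs"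
    using sum_nonneg[of "{..<Suc i}" "\<lambda>t. \<bar>kern a (real t)\<bar>"] kern_partial_abs[of i] by linarith
  finally show "(\<Sum>n. \<bar>kern a (real (Suc n) - real i) + kern a (real (Suc n) + real i)\<bar>) \<le> 3 * kabs" .
qed

lemma kern_over_power_summable: "summable (\<lambda>i. kern a (real (Suc i)) / real (Suc i) ^ (2 * m))"
proof (rule summable_comparison_test'[of _ 0])
  show "summable (\<lambda>i. \<bar>kern a (real (Suc i))\<bar>)"
    using summable_kern[of a] by (subst summable_Suc_iff)
  show "norm (kern a (real (Suc n)) / real (Suc n) ^ (2 * m)) \<le> \<bar>kern a (real (Suc n))\<bar>" for n
    using divide_left_mono[of 1 "real (Suc n) ^ (2 * m)" "\<bar>kern a (real (Suc n))\<bar>"]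
    by (simp add: abs_divide one_le_power del: of_nat_Suc)
qed

text \<open>The outer index i carries the weight; in this order the inner sums telescope.\<close>

definition double_sum where
  "double_sum = (\<Sum>i. \<Sum>n. (kern a (real (Suc n) - real (Suc i)) + kern a (real (Suc n) + real (Suc i)))
     / real (Suc i) ^ (2 * m))"

section \<open>Weighted partial fractions at non-integers and at integers\<close>

lemma cot_shift: "cot (pi * (real n + a)) = cot (pi * a)" "cot (pi * (real n - a)) = - cot (pi * a)"
proof -
  have *: "cot (pi * (b + real n)) = cot (pi * b)" for b
    using tan_periodic_nat[of "pi * b" n] by (simp add: cot_altdef algebra_simps)
  show "cot (pi * (real n + a)) = cot (pi * a)" using *[of a] by (simp add: add.commute)
  show "cot (pi * (real n - a)) = - cot (pi * a)" using *[of "- a"] by (simp add: add.commute)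
qed

lemma weighted_noninteger:
  assumes y: "y \<notin> \<int>"
  shows "(\<lambda>i. (1 / (y - real (Suc i)) + 1 / (y + real (Suc i))) / real (Suc i) ^ (2 * m)) sums
    (pi * cot (pi * y) / y ^ (2 * m) - 1 / y ^ (2 * m + 1)
      + 2 * (\<Sum>k = 1..m. zeta (real (2 * k)) / y ^ (2 * m - 2 * k + 1)))"
proof -
  have "(1 / (y - x) + 1 / (y + x)) * (y ^ 2 - x ^ 2) = 2 * y * 1" if "x \<in> \<int>" for x
  proof -
    have "y - x \<noteq> 0" "y + x \<noteq> 0"
      using y that by (auto simp: add_eq_0_iff2)
    thus ?thesis by (simp add: divide_simps) (simp add: power2_eq_square algebra_simps)
  qed
  moreover have "y \<noteq> 0" using y by auto
  ultimately show ?thesis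
    using weighted_partial_fractions[of y _ _ "\<lambda>_. 1" "\<lambda>k. zeta (real (2 * k))" m,
        OF _ cot_partial_fractions[OF y] zeta_nat_sums]
    by (simp add: diff_divide_distrib)
qed

text \<open>Removing the index n replaces zeta(2k) by zeta(2k) - n^(-2k). Each of the m corrections
  contributes the same power n^(-2m-1), doubled by the outer factor; together with the plain value
  -3/(2n) this makes the coefficient 2m + 3/2.\<close>

lemma weighted_integer:
  assumes n: "n > 0"
  shows "(\<lambda>i. (if Suc i = n then 0
          else 1 / (real n - real (Suc i)) + 1 / (real n + real (Suc i))) / real (Suc i) ^ (2 * m)) sums
    (2 * (\<Sum>k = 1..m. zeta (real (2 * k)) / real n ^ (2 * m - 2 * k + 1))
      - (2 * real m + 3 / 2) / real n ^ (2 * m + 1))"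
proof -
  define d :: "nat \<Rightarrow> real" where "d i = (if Suc i = n then 0 else 1)" for i
  have d: "(\<lambda>i. d i / real (Suc i) ^ (2 * k)) sums (zeta (real (2 * k)) - 1 / real n ^ (2 * k))"
    if "k > 0" for k
  proof -
    have "(\<lambda>i. if i = n - 1 then 1 / real (Suc i) ^ (2 * k) else 0) sums (1 / real (Suc (n - 1)) ^ (2 * k))"
      by (rule sums_single)
    from sums_diff[OF zeta_nat_sums[of "2 * k"] this] that
    have "(\<lambda>i. 1 / real (Suc i) ^ (2 * k) - (if i = n - 1 then 1 / real (Suc i) ^ (2 * k) else 0))
        sums (zeta (real (2 * k)) - 1 / real n ^ (2 * k))"
      using n by simp
    thus ?thesis
      by (rule sums_cong[THEN iffD1, rotated]) (use n in \<open>auto simp: d_def\<close>)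
  qed
  have cd: "(if Suc i = n then 0 else 1 / (real n - real (Suc i)) + 1 / (real n + real (Suc i)))
      * (real n ^ 2 - real (Suc i) ^ 2) = 2 * real n * d i" for i
  proof (cases "Suc i = n")
    case False
    hence "real n - real (Suc i) \<noteq> 0" "real n + real (Suc i) \<noteq> 0" by linarith+
    with False show ?thesis
      by (simp add: divide_simps d_def del: of_nat_Suc) (simp add: power2_eq_square algebra_simps)
  qed (simp add: d_def)
  have "(\<Sum>k = 1..m. (zeta (real (2 * k)) - 1 / real n ^ (2 * k)) / real n ^ (2 * m - 2 * k + 1))
     = (\<Sum>k = 1..m. zeta (real (2 * k)) / real n ^ (2 * m - 2 * k + 1) - 1 / real n ^ (2 * m + 1))"
  proof (intro sum.cong refl)
    fix k assume "k \<in> {1..m}"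
    hence "2 * m + 1 = 2 * k + (2 * m - 2 * k + 1)" by simp
    hence pow: "real n ^ (2 * m + 1) = real n ^ (2 * k) * real n ^ (2 * m - 2 * k + 1)"
      by (metis power_add)
    have "(z - 1 / p) / q = z / q - 1 / (p * q)" for z p q :: real
      by (simp add: diff_divide_distrib)
    thus "(zeta (real (2 * k)) - 1 / real n ^ (2 * k)) / real n ^ (2 * m - 2 * k + 1)
        = zeta (real (2 * k)) / real n ^ (2 * m - 2 * k + 1) - 1 / real n ^ (2 * m + 1)"
      unfolding pow .
  qed
  also have "\<dots> = (\<Sum>k = 1..m. zeta (real (2 * k)) / real n ^ (2 * m - 2 * k + 1))
      - real m * (1 / real n ^ (2 * m + 1))"
    by (simp only: sum_subtractf sum_constant card_atLeastAtMost) simp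
  finally have sum: "(\<Sum>k = 1..m. (zeta (real (2 * k)) - 1 / real n ^ (2 * k)) / real n ^ (2 * m - 2 * k + 1))
     = (\<Sum>k = 1..m. zeta (real (2 * k)) / real n ^ (2 * m - 2 * k + 1))
      - real m * (1 / real n ^ (2 * m + 1))" .
  have val: "- 3 / (2 * real n) / real n ^ (2 * m) + 2 * (S - real m * (1 / real n ^ (2 * m + 1)))
    = 2 * S - (2 * real m + 3 / 2) / real n ^ (2 * m + 1)" for S
    by (simp add: add_divide_distrib algebra_simps)
  have "real n \<noteq> 0" using n by simp
  from weighted_partial_fractions[OF this integer_partial_fractions[OF n] d cd, of m]
  show ?thesis unfolding sum val by blast
qed

section \<open>Summing over n first: harmonic numbers\<close>

context
  assumes m: "m > 0"
begin

lemma inverse_powers_sums: "(\<lambda>i. 1 / real (Suc i) ^ (2 * m)) sums zeta (real (2 * m))"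
  using m by (intro zeta_nat_sums) simp

lemma even_difference_summable:
  "summable (\<lambda>n. 1 / (real (Suc n) - a) ^ (2 * m) - 1 / (real (Suc n) + a) ^ (2 * m))"
  using summable_shifted_power[of "2 * m" a] summable_shifted_power[of "2 * m" "- a"] m
  by (intro summable_diff) simp_all

text \<open>Summation by parts, done as an interchange: in the triangular array \<open>F\<close>
  supported on i <= n, the rows sum to weighted tails of the kernel, and the columns collect the
  weights into harmonic numbers.\<close>

lemma gharm_kern_sums:
  "(\<lambda>n. gharm (Suc n) (2 * m) * kern a (real (Suc n))) sums
     (\<Sum>i. (ktotal - (\<Sum>t<Suc i. kern a (real t))) / real (Suc i) ^ (2 * m))"
  "summable (\<lambda>i. (ktotal - (\<Sum>t<Suc i. kern a (real t))) / real (Suc i) ^ (2 * m))"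
proof -
  define F where "F i n = (if i \<le> n then kern a (real (Suc n)) / real (Suc i) ^ (2 * m) else 0)" for i n
  \<comment> \<open>Stated for general f because it is applied both to the kernel and to its
    absolute value. The tail starts at the argument i + 1, the integer that index i stands
    for.\<close>
  have tail: "(\<lambda>n. if i \<le> n then f (real (Suc n)) else 0) sums (S - (\<Sum>t<Suc i. f (real t)))"
    if "(\<lambda>n. f (real n)) sums S" for f :: "real \<Rightarrow> real" and S i
  proof -
    have "(\<lambda>n. f (real (n + Suc i))) sums (S - (\<Sum>t<Suc i. f (real t)))"
      by (rule sums_split_initial_segment[OF that])
    thus ?thesis
      using sums_iff_shift[of "\<lambda>n. if i \<le> n then f (real (Suc n)) else 0" i] by (simp add: add_ac)
  qed
  have row: "F i sums ((ktotal - (\<Sum>t<Suc i. kern a (real t))) / real (Suc i) ^ (2 * m))" for i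
    using sums_divide[OF tail[OF kern_sums(1)], of i "real (Suc i) ^ (2 * m)"]
    by (rule sums_cong[THEN iffD1, rotated]) (simp add: F_def)
  have row_abs: "(\<lambda>n. \<bar>F i n\<bar>) sums ((kabs - (\<Sum>t<Suc i. \<bar>kern a (real t)\<bar>)) / real (Suc i) ^ (2 * m))" for i
    using sums_divide[OF tail[OF kern_sums(2)], of i "real (Suc i) ^ (2 * m)"]
    by (rule sums_cong[THEN iffD1, rotated]) (simp add: F_def abs_divide)
  have col: "(\<Sum>i. F i n) = gharm (Suc n) (2 * m) * kern a (real (Suc n))" for n
  proof -
    have "(\<Sum>i. F i n) = (\<Sum>i<Suc n. F i n)"
      by (rule suminf_finite) (auto simp: F_def)
    also have "\<dots> = (\<Sum>i<Suc n. 1 / real (Suc i) ^ (2 * m) * kern a (real (Suc n)))"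
      by (intro sum.cong) (auto simp: F_def)
    also have "\<dots> = gharm (Suc n) (2 * m) * kern a (real (Suc n))"
      unfolding gharm_def sum_distrib_right[symmetric]
      by (rule arg_cong[where f = "\<lambda>x. x * _"]) (rule sum.reindex_bij_witness[of _ "\<lambda>i. i - 1" Suc], auto)
    finally show ?thesis .
  qed
  have bound: "(\<Sum>n. \<bar>F i n\<bar>) \<le> kabs * (1 / real (Suc i) ^ (2 * m))" for i
  proof -
    have "(\<Sum>n. \<bar>F i n\<bar>) = (kabs - (\<Sum>t<Suc i. \<bar>kern a (real t)\<bar>)) / real (Suc i) ^ (2 * m)"
      by (rule sums_unique[OF row_abs, symmetric])
    also have "\<dots> \<le> kabs / real (Suc i) ^ (2 * m)"
      using sum_nonneg[of "{..<Suc i}" "\<lambda>t. \<bar>kern a (real t)\<bar>"]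
      by (intro divide_right_mono) (simp_all del: sum.lessThan_Suc)
    finally show ?thesis by simp
  qed
  note swap = sums_swap[of F, OF sums_summable[OF row_abs] bound
      summable_mult[OF sums_summable[OF inverse_powers_sums]]]
  have val: "(\<Sum>n. F i n) = (ktotal - (\<Sum>t<Suc i. kern a (real t))) / real (Suc i) ^ (2 * m)" for i
    using row[of i] by (simp add: sums_iff)
  show "(\<lambda>n. gharm (Suc n) (2 * m) * kern a (real (Suc n))) sums
     (\<Sum>i. (ktotal - (\<Sum>t<Suc i. kern a (real t))) / real (Suc i) ^ (2 * m))"
    using swap(1) unfolding col val .
  show "summable (\<lambda>i. (ktotal - (\<Sum>t<Suc i. kern a (real t))) / real (Suc i) ^ (2 * m))"
    using swap(2) unfolding val .
qed

lemma double_sum_swap: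
  "(\<lambda>n. \<Sum>i. (kern a (real (Suc n) - real (Suc i)) + kern a (real (Suc n) + real (Suc i)))
     / real (Suc i) ^ (2 * m)) sums double_sum"
  unfolding double_sum_def
proof (rule sums_swap(1))
  fix i
  show "summable (\<lambda>n. \<bar>(kern a (real (Suc n) - real (Suc i)) + kern a (real (Suc n) + real (Suc i)))
     / real (Suc i) ^ (2 * m)\<bar>)"
    using summable_divide[OF shifted_kern_abs(1)[of "Suc i"], of "real (Suc i) ^ (2 * m)"]
    by (simp add: abs_divide)
  show "(\<Sum>n. \<bar>(kern a (real (Suc n) - real (Suc i)) + kern a (real (Suc n) + real (Suc i)))
     / real (Suc i) ^ (2 * m)\<bar>) \<le> 3 * kabs * (1 / real (Suc i) ^ (2 * m))"
    using divide_right_mono[OF shifted_kern_abs(2)[of "Suc i"], of "real (Suc i) ^ (2 * m)"]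
      suminf_divide[OF shifted_kern_abs(1)[of "Suc i"], of "real (Suc i) ^ (2 * m)"]
    by (simp add: abs_divide)
  show "summable (\<lambda>i. 3 * kabs * (1 / real (Suc i) ^ (2 * m)))"
    by (intro summable_mult sums_summable[OF inverse_powers_sums])
qed

text \<open>For each i the inner sum is twice a kernel tail minus h(i); the weighted tails are then
  turned into harmonic numbers by \<open>gharm_kern_sums\<close>.\<close>

lemma double_sum_by_columns:
  "double_sum = 2 * (\<Sum>n. gharm (Suc n) (2 * m) * kern a (real (Suc n)))
     - (\<Sum>i. kern a (real (Suc i)) / real (Suc i) ^ (2 * m))"
proof -
  have "(\<Sum>n. (kern a (real (Suc n) - real (Suc i)) + kern a (real (Suc n) + real (Suc i)))
     / real (Suc i) ^ (2 * m)) = 2 * ((ktotal - (\<Sum>t<Suc i. kern a (real t))) / real (Suc i) ^ (2 * m))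
       - kern a (real (Suc i)) / real (Suc i) ^ (2 * m)" for i
    using sums_divide[OF shifted_kern_sums[of "Suc i"], of "real (Suc i) ^ (2 * m)"]
    by (simp add: sums_iff diff_divide_distrib)
  moreover have "(\<lambda>i. 2 * ((ktotal - (\<Sum>t<Suc i. kern a (real t))) / real (Suc i) ^ (2 * m))
       - kern a (real (Suc i)) / real (Suc i) ^ (2 * m)) sums
      (2 * (\<Sum>n. gharm (Suc n) (2 * m) * kern a (real (Suc n)))
     - (\<Sum>i. kern a (real (Suc i)) / real (Suc i) ^ (2 * m)))"
    unfolding sums_unique[OF gharm_kern_sums(1), symmetric]
    by (intro sums_diff sums_mult summable_sums gharm_kern_sums(2) kern_over_power_summable)
  ultimately show ?thesis
    unfolding double_sum_def by (simp only: sums_iff)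
qed

end

section \<open>Summing over i first: cotangent and zeta values\<close>

context
  assumes a: "a \<notin> \<int>"
begin

lemma nonint: "real n + a \<notin> \<int>" "real n - a \<notin> \<int>"
  using a Ints_diff[of "real n + a" "real n"] Ints_diff[of "real n" "real n - a"] by auto

lemma nonzero: "real n + a \<noteq> 0" "real n - a \<noteq> 0" "a \<noteq> 0"
proof -
  have "a \<noteq> - real n" "a \<noteq> real n" using a by auto
  thus "real n + a \<noteq> 0" "real n - a \<noteq> 0" by linarith+
  show "a \<noteq> 0" using a by auto
qed

text \<open>Regrouping h(n-i) + h(n+i) by poles gives the partial fraction terms at n + a and n - a
  minus twice those at n, apart from a correction on the diagonal i = n.\<close>

lemma row_value:
  assumes n: "n > 0"
  shows "(\<Sum>i. (kern a (real n - real (Suc i)) + kern a (real n + real (Suc i))) / real (Suc i) ^ (2 * m))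
   = - pi * cot (pi * a) * (1 / (real n - a) ^ (2 * m) - 1 / (real n + a) ^ (2 * m))
     + 2 * (\<Sum>k = 1..m. zeta (real (2 * k)) *
         (1 / (real n + a) ^ (2 * m - 2 * k + 1) + 1 / (real n - a) ^ (2 * m - 2 * k + 1)
           - 2 / real n ^ (2 * m - 2 * k + 1)))
     - (1 / (real n + a) ^ (2 * m + 1) + 1 / (real n - a) ^ (2 * m + 1) - 2 / real n ^ (2 * m + 1))
     + 4 * real m * (1 / real n ^ (2 * m + 1))"
    (is "_ = ?R")
proof -
  let ?q = "\<lambda>y i. 1 / (y - real (Suc i)) + 1 / (y + real (Suc i))"
  let ?c = "\<lambda>i. if Suc i = n then 0 else ?q (real n) i"
  let ?w = "\<lambda>i. real (Suc i) ^ (2 * m)"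
  have single: "(\<lambda>i. if i = n - 1 then 1 / real n ^ (2 * m + 1) else 0) sums (1 / real n ^ (2 * m + 1))"
    by (rule sums_single)
  note S = sums_diff[OF sums_diff[OF sums_add[OF weighted_noninteger[OF nonint(1)[of n]]
      weighted_noninteger[OF nonint(2)[of n]]] sums_mult[OF weighted_integer[OF n], of 2]] single]
  have term_eq: "?q (real n + a) i / ?w i + ?q (real n - a) i / ?w i - 2 * (?c i / ?w i)
      - (if i = n - 1 then 1 / real n ^ (2 * m + 1) else 0)
    = (kern a (real n - real (Suc i)) + kern a (real n + real (Suc i))) / ?w i" for i
  proof -
    \<comment> \<open>For i = n the terms 1/a and -1/a cancel and h(0) = 0, while h(2n) contains
      -2/(2n), which the truncated series at n does not have; hence the correction 1/n.\<close>
    have *: "?q (real n + a) i + ?q (real n - a) i - 2 * ?c i - (if i = n - 1 then 1 / real n else 0)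
      = kern a (real n - real (Suc i)) + kern a (real n + real (Suc i))"
    proof (cases "Suc i = n")
      case True
      hence "real (Suc i) = real n" "i = n - 1" by simp_all
      moreover have "kern a (real n + real n)
          = 1 / (real n + real n + a) + 1 / (real n + real n - a) - 1 / real n"
        using n by (simp add: kern_def)
      ultimately show ?thesis using True by (simp add: kern_def add_ac)
    next
      case False
      hence "i \<noteq> n - 1" "real n - real (Suc i) \<noteq> 0" "real n + real (Suc i) \<noteq> 0"
        using n by (auto simp del: of_nat_Suc)
      moreover have "1 / (b + a - x) + 1 / (b + a + x) + (1 / (b - a - x) + 1 / (b - a + x))
          - 2 * (1 / (b - x) + 1 / (b + x)) = kern a (b - x) + kern a (b + x)"
        if "b - x \<noteq> 0" "b + x \<noteq> 0" for b x :: real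
        using that by (simp add: kern_def algebra_simps)
      ultimately show ?thesis using False by simp
    qed
    have "(if i = n - 1 then 1 / real n ^ (2 * m + 1) else 0)
        = (if i = n - 1 then 1 / real n else 0) / ?w i"
      using n by auto
    thus ?thesis
      unfolding *[symmetric] by (simp only: add_divide_distrib diff_divide_distrib times_divide_eq_right)
  qed
  \<comment> \<open>The coefficient of n^(-2m-1) is 2(2m + 3/2) - 1 = 4m + 2. The 2 completes the
    difference of odd powers, and 4m produces the multiple of zeta(2m+1).\<close>
  have value_eq: "pi * cot (pi * (real n + a)) / (real n + a) ^ (2 * m) - 1 / (real n + a) ^ (2 * m + 1)
      + 2 * (\<Sum>k = 1..m. zeta (real (2 * k)) / (real n + a) ^ (2 * m - 2 * k + 1))
    + (pi * cot (pi * (real n - a)) / (real n - a) ^ (2 * m) - 1 / (real n - a) ^ (2 * m + 1)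
      + 2 * (\<Sum>k = 1..m. zeta (real (2 * k)) / (real n - a) ^ (2 * m - 2 * k + 1)))
    - 2 * (2 * (\<Sum>k = 1..m. zeta (real (2 * k)) / real n ^ (2 * m - 2 * k + 1))
      - (2 * real m + 3 / 2) / real n ^ (2 * m + 1))
    - 1 / real n ^ (2 * m + 1) = ?R"
  proof -
    define P Q A B N where "P = (real n + a) ^ (2 * m)" and "Q = (real n - a) ^ (2 * m)"
      and "A = (real n + a) ^ (2 * m + 1)" and "B = (real n - a) ^ (2 * m + 1)"
      and "N = real n ^ (2 * m + 1)"
    have sum: "(\<Sum>k = 1..m. zeta (real (2 * k)) *
         (1 / (real n + a) ^ (2 * m - 2 * k + 1) + 1 / (real n - a) ^ (2 * m - 2 * k + 1)
           - 2 / real n ^ (2 * m - 2 * k + 1)))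
      = (\<Sum>k = 1..m. zeta (real (2 * k)) / (real n + a) ^ (2 * m - 2 * k + 1))
        + (\<Sum>k = 1..m. zeta (real (2 * k)) / (real n - a) ^ (2 * m - 2 * k + 1))
        - 2 * (\<Sum>k = 1..m. zeta (real (2 * k)) / real n ^ (2 * m - 2 * k + 1))"
      by (simp add: sum.distrib sum_subtractf sum_distrib_left algebra_simps)
    show ?thesis
      unfolding sum cot_shift P_def[symmetric] Q_def[symmetric] A_def[symmetric] B_def[symmetric] N_def[symmetric]
      by (simp add: algebra_simps add_divide_distrib)
  qed
  show ?thesis
    using S unfolding term_eq value_eq by (rule sums_unique[symmetric])
qed

text \<open>For j = 0 only the combination converges, and it is the kernel itself. For j > 0 each of
  the three series converges separately.\<close>

lemma odd_sum_summable:
  "summable (\<lambda>n. 1 / (real (Suc n) + a) ^ (2 * j + 1) + 1 / (real (Suc n) - a) ^ (2 * j + 1)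
     - 2 / real (Suc n) ^ (2 * j + 1))"
proof (cases "j = 0")
  case True
  have "summable (\<lambda>n. kern a (real (Suc n)))"
    using sums_summable[OF kern_sums(1)] by (subst summable_Suc_iff)
  thus ?thesis using True by (simp add: kern_def)
next
  case False
  hence "2 * j + 1 \<ge> 2" by simp
  from summable_shifted_power[OF this, of a] summable_shifted_power[OF this, of "- a"]
    summable_mult[OF summable_shifted_power[OF this, of 0], of 2]
  show ?thesis by (intro summable_diff summable_add) (simp_all del: power_Suc)
qed

lemma kern_rational: "kern a (real n) = 2 * a ^ 2 * (1 / (real n * (real n ^ 2 - a ^ 2)))"
proof -
  have "real n \<noteq> a" "real n \<noteq> - a" using nonzero(1,2)[of n] by linarith+
  from kern_eq[OF this] show ?thesis by simp
qed

context
  assumes m: "m > 0"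
begin

text \<open>The row values are summed over n piece by piece, each piece being summable on its own,
  and the result is identified with the interchanged double sum by uniqueness of limits.\<close>

lemma double_sum_by_rows:
  "double_sum = - pi * cot (pi * a)
      * (\<Sum>n. 1 / (real (Suc n) - a) ^ (2 * m) - 1 / (real (Suc n) + a) ^ (2 * m))
     + 2 * (\<Sum>k = 1..m. zeta (real (2 * k)) *
         (\<Sum>n. 1 / (real (Suc n) + a) ^ (2 * m - 2 * k + 1) + 1 / (real (Suc n) - a) ^ (2 * m - 2 * k + 1)
           - 2 / real (Suc n) ^ (2 * m - 2 * k + 1)))
     - (\<Sum>n. 1 / (real (Suc n) + a) ^ (2 * m + 1) + 1 / (real (Suc n) - a) ^ (2 * m + 1)
         - 2 / real (Suc n) ^ (2 * m + 1))
     + 4 * real m * zeta (real (2 * m + 1))"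
proof -
  \<comment> \<open>The exponent is 2(m - k) + 1, so the case k = m is the one where only the
    combined terms converge.\<close>
  have odd: "summable (\<lambda>n. 1 / (real (Suc n) + a) ^ (2 * m - 2 * k + 1)
      + 1 / (real (Suc n) - a) ^ (2 * m - 2 * k + 1) - 2 / real (Suc n) ^ (2 * m - 2 * k + 1))" for k
    using odd_sum_summable[of "m - k"] by (simp add: diff_mult_distrib2)
  note s = sums_add[OF sums_diff[OF sums_add[OF
      sums_mult[OF summable_sums[OF even_difference_summable[OF m]], of "- pi * cot (pi * a)"]
      sums_mult[OF sums_sum[OF sums_mult[OF summable_sums[OF odd]]], of 2]]
      summable_sums[OF odd_sum_summable[of m]]]
      sums_mult[OF zeta_nat_sums[of "2 * m + 1"], of "4 * real m"]]
  show ?thesis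
    by (rule sums_unique2[OF double_sum_swap[OF m, unfolded row_value[OF zero_less_Suc]]])
       (rule s, use m in simp)
qed

lemma gharm_series:
  "summable (\<lambda>n. gharm (Suc n) (2 * m) / (real (Suc n) * (real (Suc n) ^ 2 - a ^ 2)))"
  "(\<Sum>n. gharm (Suc n) (2 * m) * kern a (real (Suc n)))
     = 2 * a ^ 2 * (\<Sum>n. gharm (Suc n) (2 * m) / (real (Suc n) * (real (Suc n) ^ 2 - a ^ 2)))"
proof -
  have eq: "gharm (Suc n) (2 * m) * kern a (real (Suc n))
      = 2 * a ^ 2 * (gharm (Suc n) (2 * m) / (real (Suc n) * (real (Suc n) ^ 2 - a ^ 2)))" for n
    unfolding kern_rational by simp
  show *: "summable (\<lambda>n. gharm (Suc n) (2 * m) / (real (Suc n) * (real (Suc n) ^ 2 - a ^ 2)))"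
    using sums_summable[OF gharm_kern_sums(1)[OF m]] nonzero(3) unfolding eq by (subst (asm) summable_cmult_iff) auto
  show "(\<Sum>n. gharm (Suc n) (2 * m) * kern a (real (Suc n)))
     = 2 * a ^ 2 * (\<Sum>n. gharm (Suc n) (2 * m) / (real (Suc n) * (real (Suc n) ^ 2 - a ^ 2)))"
    unfolding eq by (rule suminf_mult[OF *])
qed

lemma power_series:
  "summable (\<lambda>n. 1 / (real (Suc n) ^ (2 * m + 1) * (real (Suc n) ^ 2 - a ^ 2)))"
  "(\<Sum>n. kern a (real (Suc n)) / real (Suc n) ^ (2 * m))
     = 2 * a ^ 2 * (\<Sum>n. 1 / (real (Suc n) ^ (2 * m + 1) * (real (Suc n) ^ 2 - a ^ 2)))"
proof -
  have eq: "kern a (real (Suc n)) / real (Suc n) ^ (2 * m)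
      = 2 * a ^ 2 * (1 / (real (Suc n) ^ (2 * m + 1) * (real (Suc n) ^ 2 - a ^ 2)))" for n
    unfolding kern_rational by (simp add: mult_ac)
  show *: "summable (\<lambda>n. 1 / (real (Suc n) ^ (2 * m + 1) * (real (Suc n) ^ 2 - a ^ 2)))"
    using kern_over_power_summable nonzero(3) unfolding eq by (subst (asm) summable_cmult_iff) auto
  show "(\<Sum>n. kern a (real (Suc n)) / real (Suc n) ^ (2 * m))
     = 2 * a ^ 2 * (\<Sum>n. 1 / (real (Suc n) ^ (2 * m + 1) * (real (Suc n) ^ 2 - a ^ 2)))"
    unfolding eq by (rule suminf_mult[OF *])
qed

end

end

end

section \<open>Comparison of the two evaluations\<close>

theorem theorem2p3:
  fixes m :: nat and a :: real
  assumes "m > 0" and "a \<notin> \<int>"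
  shows
    "(\<Sum>n. gharm (Suc n) (2*m) / (real (Suc n) * (real (Suc n) ^ 2 - a ^ 2)))
      = 1/2 * (\<Sum>n. 1 / (real (Suc n) ^ (2*m+1) * (real (Suc n) ^ 2 - a ^ 2)))
        - pi * cot (pi * a) / (4 * a ^ 2)
            * (\<Sum>n. 1 / (real (Suc n) - a) ^ (2*m) - 1 / (real (Suc n) + a) ^ (2*m))
        + 1 / (2 * a ^ 2)
            * (\<Sum>k=1..m. zeta (real (2*k))
                * (\<Sum>n. 1 / (real (Suc n) + a) ^ (2*m-2*k+1)
                       + 1 / (real (Suc n) - a) ^ (2*m-2*k+1)
                       - 2 / real (Suc n) ^ (2*m-2*k+1)))
        + real m / a ^ 2 * zeta (real (2*m+1))
        - 1 / (4 * a ^ 2)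
            * (\<Sum>n. 1 / (real (Suc n) + a) ^ (2*m+1)
                   + 1 / (real (Suc n) - a) ^ (2*m+1)
                   - 2 / real (Suc n) ^ (2*m+1))
     \<and> summable (\<lambda>n. gharm (Suc n) (2*m) / (real (Suc n) * (real (Suc n) ^ 2 - a ^ 2)))
     \<and> summable (\<lambda>n. 1 / (real (Suc n) ^ (2*m+1) * (real (Suc n) ^ 2 - a ^ 2)))
     \<and> summable (\<lambda>n. 1 / (real (Suc n) - a) ^ (2*m) - 1 / (real (Suc n) + a) ^ (2*m))
     \<and> (\<forall>k\<in>{1..m}. summable (\<lambda>n. 1 / (real (Suc n) + a) ^ (2*m-2*k+1)
                                   + 1 / (real (Suc n) - a) ^ (2*m-2*k+1)
                                   - 2 / real (Suc n) ^ (2*m-2*k+1)))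
     \<and> summable (\<lambda>n. 1 / (real (Suc n) + a) ^ (2*m+1)
                     + 1 / (real (Suc n) - a) ^ (2*m+1)
                     - 2 / real (Suc n) ^ (2*m+1))"
proof -
  define C where "C = pi * cot (pi * a)"
  define L where "L = (\<Sum>n. gharm (Suc n) (2*m) / (real (Suc n) * (real (Suc n) ^ 2 - a ^ 2)))"
  define A where "A = (\<Sum>n. 1 / (real (Suc n) ^ (2*m+1) * (real (Suc n) ^ 2 - a ^ 2)))"
  define B where "B = (\<Sum>n. 1 / (real (Suc n) - a) ^ (2*m) - 1 / (real (Suc n) + a) ^ (2*m))"
  define Z where "Z = (\<Sum>k=1..m. zeta (real (2*k))
                * (\<Sum>n. 1 / (real (Suc n) + a) ^ (2*m-2*k+1)
                       + 1 / (real (Suc n) - a) ^ (2*m-2*k+1)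
                       - 2 / real (Suc n) ^ (2*m-2*k+1)))"
  define D where "D = (\<Sum>n. 1 / (real (Suc n) + a) ^ (2*m+1)
                   + 1 / (real (Suc n) - a) ^ (2*m+1)
                   - 2 / real (Suc n) ^ (2*m+1))"
  \<comment> \<open>Both evaluations of the double sum are equated. The factors 2 a^2 come from h(n)
    = 2 a^2 / (n (n^2 - a^2)); dividing by 4 a^2, which is nonzero, isolates
    \<open>L\<close>.\<close>
  have "2 * (2 * a ^ 2 * L) - 2 * a ^ 2 * A = - C * B + 2 * Z - D + 4 * real m * zeta (real (2*m+1))"
    using double_sum_by_columns[OF assms(1), of a] double_sum_by_rows[OF assms(2,1)]
    unfolding gharm_series(2)[OF assms(2,1)] power_series(2)[OF assms(2,1)]
    by (simp only: L_def A_def B_def Z_def D_def C_def mult_minus_left)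
  hence "L = (2 * a ^ 2 * A - C * B + 2 * Z - D + 4 * real m * zeta (real (2*m+1))) / (4 * a ^ 2)"
    using nonzero(3)[OF assms(2)] by (simp add: eq_divide_eq algebra_simps)
  also have "\<dots> = 1/2 * A - C / (4 * a ^ 2) * B + 1 / (2 * a ^ 2) * Z
      + real m / a ^ 2 * zeta (real (2*m+1)) - 1 / (4 * a ^ 2) * D"
    using nonzero(3)[OF assms(2)] by (simp add: add_divide_distrib diff_divide_distrib)
  finally have "L = 1/2 * A - C / (4 * a ^ 2) * B + 1 / (2 * a ^ 2) * Z
      + real m / a ^ 2 * zeta (real (2*m+1)) - 1 / (4 * a ^ 2) * D" .
  moreover have "summable (\<lambda>n. 1 / (real (Suc n) + a) ^ (2*m-2*k+1)
      + 1 / (real (Suc n) - a) ^ (2*m-2*k+1) - 2 / real (Suc n) ^ (2*m-2*k+1))" for k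
    using odd_sum_summable[OF assms(2), of "m - k"] by (simp add: diff_mult_distrib2)
  ultimately show ?thesis
    unfolding L_def A_def B_def Z_def D_def C_def
    using gharm_series(1)[OF assms(2,1)] power_series(1)[OF assms(2,1)]
      even_difference_summable[OF assms(1)] odd_sum_summable[OF assms(2), of m]
    by blast
qed

end
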